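(* Let $\mathbb P,\mathbb X,\mathbb Y$ be real Banach spaces, let $C$ be a closed convex cone with $\{\mathbf 0\}\subsetneqq C\subsetneqq\mathbb Y$, let $\varphi:\mathbb P\times\mathbb X\to\mathbb R$, and let $F:\mathbb P\times\mathbb X\rightrightarrows\mathbb Y$ be a set-valued mapping with nonempty closed values. For $p\in\mathbb P$ put $\mathsf R(p)=\{x\in\mathbb X\mid F(p,x)\subseteq C\}$, $\mathsf{val}(p)=\inf_{x\in\mathsf R(p)}\varphi(p,x)$ and $\mathsf{Argmin}(p)=\{x\in\mathsf R(p)\mid\varphi(p,x)=\mathsf{val}(p)\}$. Assume that the family of problems of minimizing $\varphi(p,x)$ over $x\in\mathbb X$ subject to $F(p,x)\subseteq C$ ($p\in\mathbb P$) is a q.c.s.v.i. family (defined in the context), and that $\mathsf{val}\not\equiv-\infty$. Let $\bar p\in\mathbb P$ and $\bar x\in\mathsf{Argmin}(\bar p)$. If the sets $\mathrm{epi}\,\varphi$ and $\mathrm{gph}\,\mathsf R\times\mathbb R$ are subtransversal at $(\bar p,\bar x,\varphi(\bar p,\bar x))$, then $$\partial\mathsf{val}(\bar p)=\{p^*+q^*\mid (p^*,x^* )\in\partial\varphi(\bar p,\bar x)\ \text{ and }\ (q^*,-x^* )\in\mathrm{cone}\,\partial\,\mathrm{exc}(F(\cdot);C)(\bar p,\bar x)\},$$ where $\partial\,\mathrm{exc}(F(\cdot);C)(\bar p,\bar x)$ is the subdifferential at $(\bar p,\bar x)$ of the function $(p,x)\mapsto\mathrm{exc}(F(p,x);C)$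 on $\mathbb P\times\mathbb X$.
   Context: Conventions: $\inf\varnothing=+\infty$. $\mathrm{dist}(y;S)=\inf_{s\in S}\|y-s\|$; $\mathrm{exc}(A;B)=\sup_{a\in A}\mathrm{dist}(a;B)$. For a nonempty set $S$ and $r\ge0$, $\mathrm B[S;r]=\{y\mid\mathrm{dist}(y;S)\le r\}$; for a point $x$, $\mathrm B[x;r]$ is the closed ball. $\mathrm{gph}$ and $\mathrm{epi}$ denote graph and epigraph; $\mathrm{cone}\,S=\{ts\mid t\ge0,\ s\in S\}$ for a convex set $S$ (conical hull). $\partial\psi(\bar z)=\{z^*\mid\langle z^*,z-\bar z\rangle\le\psi(z)-\psi(\bar z)\ \forall z\}$ is the subdifferential of convex analysis (with $z^*$ in the topological dual). q.c.s.v.i. (qualified convex with set-valued inclusion constraints) family: the family given by $(\varphi,F,C)$ is q.c.s.v.i. if (i) $\varphi$ is convex and continuous on $\mathbb P\times\mathbb X$; (ii) for every $p\in\mathbb P$ there is $\hat x_p\in\mathbb X$ such that $F(p,\hat x_p)$ is $C$-bounded, i.e. $F(p,\hat x_p)\setminus C$ is norm-bounded; (iii) for every $p$, $F(p,\cdot)$ is lower semicontinuous on $\mathbb X$; (iv) $F$ is $C$-concave: $F(t(p_1,x_1)+(1-t)(p_2,x_2))\subseteq tF(p_1,x_1)+(1-t)F(p_2,x_2)+C$ for all $(p_i,x_i)\in\mathbb P\times\mathbb X$, $t\in[0,1]$; (v) for every $x$, $F(\cdot,x)$ is Hausdorff $C$-upper semicontinuous on $\mathbb P$: for every $p_0\in\mathbb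 P$ and $\varepsilon>0$ there is $\delta>0$ with $F(p,x)\subseteq\mathrm B[F(p_0,x)+C;\varepsilon]$ for all $p\in\mathrm B[p_0;\delta]$; (vi) $\alpha_F>1$, where $\alpha_F=\inf\{\mathrm{inc}(F(p,\cdot);x)\mid(p,x)\in\mathbb P\times\mathbb X,\ F(p,x)\not\subseteq C\}$. Here, for $G:\mathbb X\rightrightarrows\mathbb Y$ and $x_0\in\mathbb X$, $\mathrm{inc}(G;x_0)$ is the supremum of all $\alpha>1$ for which there is $\delta>0$ such that for all $r\in(0,\delta]$ there exists $u\in\mathrm B[x_0;r]$ with $\mathrm B[G(u);\alpha r]\subseteq\mathrm B[G(x_0)+C;r]$ (with $\sup\varnothing=-\infty$). Subtransversality: nonempty subsets $A,B$ of a normed space are subtransversal at $\bar z\in A\cap B$ if there exist $\kappa,r>0$ such that $\mathrm{dist}(z;A\cap B)\le\kappa\max\{\mathrm{dist}(z;A),\mathrm{dist}(z;B)\}$ for all $z\in\mathrm B[\bar z;r]$. Here the normed space is $\mathbb P\times\mathbb X\times\mathbb R$ with any standard product norm. *)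

theory Defs
  imports "HOL-Analysis.Analysis"
begin

text \<open>The distance to a set is rendered by \<^const>\<open>infdist\<close>, which is \<open>0\<close> rather than
  \<open>+\<infinity>\<close> for the empty set.  All target sets below (the cone \<open>C\<close>, sums \<open>F z + C\<close> with nonempty
  \<open>F z\<close>, and the sets in the definition of subtransversality) are nonempty in their intended use,
  so the two conventions agree.\<close>

definition excess :: "'a::metric_space set \<Rightarrow> 'a set \<Rightarrow> ereal" where
  "excess A B = (SUP a\<in>A. ereal (infdist a B))"

definition enlargement :: "'a::metric_space set \<Rightarrow> real \<Rightarrow> 'a set" where
  "enlargement S r = {y. infdist y S \<le> r}"

text \<open>Subgradients are elements of the topological dual \<^typ>\<open>'a \<Rightarrow>\<^sub>L real\<close>.  At points where the
  function is not finite the subdifferential is taken to be empty.\<close>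

definition subdifferential ::
    "('a::real_normed_vector \<Rightarrow> ereal) \<Rightarrow> 'a \<Rightarrow> ('a \<Rightarrow>\<^sub>L real) set" where
  "subdifferential \<psi> z0 =
     {f. \<bar>\<psi> z0\<bar> \<noteq> \<infinity> \<and> (\<forall>z. ereal (blinfun_apply f (z - z0)) \<le> \<psi> z - \<psi> z0)}"

text \<open>The functional \<open>(p, x) \<mapsto> f p + g x\<close>: the standard identification of pairs of functionals
  with functionals on the product.\<close>

definition dual_pair ::
    "('p::real_normed_vector \<Rightarrow>\<^sub>L real) \<Rightarrow> ('x::real_normed_vector \<Rightarrow>\<^sub>L real) \<Rightarrow> ('p \<times> 'x) \<Rightarrow>\<^sub>L real"
  where "dual_pair f g = (f o\<^sub>L fst_blinfun) + (g o\<^sub>L snd_blinfun)"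

definition subtransversal_at ::
    "'a::real_normed_vector set \<Rightarrow> 'a set \<Rightarrow> 'a \<Rightarrow> bool" where
  "subtransversal_at A B z0 \<longleftrightarrow> z0 \<in> A \<inter> B \<and>
     (\<exists>\<kappa>>0. \<exists>r>0. \<forall>z\<in>cball z0 r.
        infdist z (A \<inter> B) \<le> \<kappa> * max (infdist z A) (infdist z B))"

definition lsc_multimap :: "('x::topological_space \<Rightarrow> 'y::topological_space set) \<Rightarrow> bool" where
  "lsc_multimap G \<longleftrightarrow>
     (\<forall>x0 V. open V \<and> G x0 \<inter> V \<noteq> {} \<longrightarrow> (\<exists>U. open U \<and> x0 \<in> U \<and> (\<forall>x\<in>U. G x \<inter> V \<noteq> {})))"

definition cone_bounded :: "'y::real_normed_vector set \<Rightarrow> 'y set \<Rightarrow> bool" where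
  "cone_bounded C A \<longleftrightarrow> bounded (A - C)"

definition cone_concave ::
    "'y::real_vector set \<Rightarrow> ('z::real_vector \<Rightarrow> 'y set) \<Rightarrow> bool" where
  "cone_concave C F \<longleftrightarrow>
     (\<forall>z1 z2. \<forall>t\<in>{0..1}.
        F (t *\<^sub>R z1 + (1 - t) *\<^sub>R z2)
          \<subseteq> (\<lambda>y. t *\<^sub>R y) ` F z1 + (\<lambda>y. (1 - t) *\<^sub>R y) ` F z2 + C)"

definition hausdorff_cone_usc ::
    "'y::real_normed_vector set \<Rightarrow> ('p::metric_space \<Rightarrow> 'y set) \<Rightarrow> bool" where
  "hausdorff_cone_usc C G \<longleftrightarrow>
     (\<forall>p0. \<forall>\<epsilon>>0. \<exists>\<delta>>0. \<forall>p\<in>cball p0 \<delta>. G p \<subseteq> enlargement (G p0 + C) \<epsilon>)"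

text \<open>The supremum is taken in \<^typ>\<open>ereal\<close>, so it is \<open>-\<infinity>\<close> if there is no admissible \<open>\<alpha>\<close>.\<close>

definition inc ::
    "'y::real_normed_vector set \<Rightarrow> ('x::metric_space \<Rightarrow> 'y set) \<Rightarrow> 'x \<Rightarrow> ereal" where
  "inc C G x0 =
     Sup (ereal ` {\<alpha>. \<alpha> > 1 \<and>
       (\<exists>\<delta>>0. \<forall>r\<in>{0<..\<delta>}. \<exists>u\<in>cball x0 r.
          enlargement (G u) (\<alpha> * r) \<subseteq> enlargement (G x0 + C) r)})"

definition inc_bound ::
    "'y::real_normed_vector set \<Rightarrow> ('p \<times> 'x::metric_space \<Rightarrow> 'y set) \<Rightarrow> ereal" where
  "inc_bound C F = Inf {inc C (\<lambda>x. F (p, x)) x0 | p x0. \<not> F (p, x0) \<subseteq> C}"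

definition qcsvi ::
    "('p::real_normed_vector \<times> 'x::real_normed_vector \<Rightarrow> real) \<Rightarrow>
     ('p \<times> 'x \<Rightarrow> 'y::real_normed_vector set) \<Rightarrow> 'y set \<Rightarrow> bool" where
  "qcsvi \<phi> F C \<longleftrightarrow>
     convex_on UNIV \<phi> \<and> continuous_on UNIV \<phi> \<and>
     (\<forall>p. \<exists>x. cone_bounded C (F (p, x))) \<and>
     (\<forall>p. lsc_multimap (\<lambda>x. F (p, x))) \<and>
     cone_concave C F \<and>
     (\<forall>x. hausdorff_cone_usc C (\<lambda>p. F (p, x))) \<and>
     inc_bound C F > 1"

definition feasible :: "('p \<times> 'x \<Rightarrow> 'y set) \<Rightarrow> 'y set \<Rightarrow> 'p \<Rightarrow> 'x set" where
  "feasible F C p = {x. F (p, x) \<subseteq> C}"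

definition graph_of :: "('p \<Rightarrow> 'x set) \<Rightarrow> ('p \<times> 'x) set" where
  "graph_of R = {(p, x). x \<in> R p}"

definition optval ::
    "('p \<times> 'x \<Rightarrow> real) \<Rightarrow> ('p \<times> 'x \<Rightarrow> 'y set) \<Rightarrow> 'y set \<Rightarrow> 'p \<Rightarrow> ereal" where
  "optval \<phi> F C p = (INF x\<in>feasible F C p. ereal (\<phi> (p, x)))"

definition argmin_set ::
    "('p \<times> 'x \<Rightarrow> real) \<Rightarrow> ('p \<times> 'x \<Rightarrow> 'y set) \<Rightarrow> 'y set \<Rightarrow> 'p \<Rightarrow> 'x set" where
  "argmin_set \<phi> F C p = {x \<in> feasible F C p. ereal (\<phi> (p, x)) = optval \<phi> F C p}"

end

theory Submission
  imports Defs
begin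

text \<open>Write \<open>z0 = (pbar, xbar)\<close> and let \<open>S\<close> be the graph of the feasible-set map, i.e. the zero set of
  \<open>e z = excess (F z) C\<close>.  Since \<open>xbar\<close> is a minimiser at \<open>pbar\<close>, a functional \<open>f\<close> is a subgradient of
  the value function at \<open>pbar\<close> exactly when \<open>(p, x) \<mapsto> f p\<close> supports \<open>\<phi>\<close> from below at \<open>z0\<close> along \<open>S\<close>
  (\<open>subdifferential_optval_iff\<close>): minimising over \<open>x\<close> is the same as allowing all \<open>x\<close> in the subgradient
  inequality.  Two facts then give the formula.

  First, a functional supporting the continuous convex function \<open>\<phi>\<close> along the convex set \<open>S\<close> is a sum of
  a global subgradient of \<open>\<phi>\<close> and an element of the normal cone of \<open>S\<close> at \<open>z0\<close>
  (\<open>subgradient_sum_rule\<close>).  This is a Hahn--Banach argument; because \<open>\<phi>\<close> is finite and continuous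
  everywhere, every algebraic linear minorant it provides is automatically bounded.  Convexity of \<open>S\<close>
  comes from the \<open>C\<close>-concavity of \<open>F\<close>.

  Second, this normal cone is the cone generated by the subgradients of \<open>e\<close> at \<open>z0\<close>
  (\<open>normal_cone_eq_cone_subdifferential_excess\<close>).  The nontrivial inclusion rests on a global error
  bound: the distance from \<open>z\<close> to \<open>S\<close> is at most a constant times \<open>e z\<close>, so that a functional that is
  nonpositive on \<open>S - z0\<close> is bounded above by a multiple of \<open>e\<close>.  The error bound
  (\<open>feasibility_error_bound\<close>) is where \<open>inc_bound C F > 1\<close> enters.  If \<open>1 < \<alpha> < inc_bound C F\<close>, then from
  any infeasible \<open>x\<close> with finite excess one can move by at most a small \<open>r\<close> to a point whose value set,
  even when enlarged by \<open>\<alpha> r\<close>, lies within \<open>r\<close> of \<open>F (p, x) + C\<close>.  Enlarging a set that is not contained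
  in \<open>C\<close> by \<open>\<alpha> r\<close> raises its excess by \<open>\<alpha> r\<close>, and for small \<open>r\<close> the new point is
  still infeasible by lower semicontinuity, so the move lowers the excess by at least \<open>(\<alpha> - 1) r\<close>.
  Lower semicontinuity and completeness turn this local descent into a feasible point at distance at most
  \<open>e (p, x) / (\<alpha> - 1)\<close>.\<close>

section \<open>Linear minorants of convex functions\<close>

text \<open>Hahn--Banach for a convex (rather than sublinear) majorant.  Zorn's lemma is applied to partial linear
  functionals represented by their graphs, as linear subspaces of \<^typ>\<open>'a \<times> real\<close> below the graph of
  \<open>k\<close>.  Such subspaces need not be required to be single-valued: a subspace containing two values
  over one point contains the whole vertical line over \<open>0\<close>, which cannot stay below \<open>k 0\<close>.\<close>

lemma convex_dominates_linear:
  fixes k :: "'a::real_vector \<Rightarrow> real"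
  assumes cvx: "convex_on UNIV k" and k0: "0 \<le> k 0"
  shows "\<exists>g. linear g \<and> (\<forall>x. g x \<le> k x)"
proof -
  define \<G> where "\<G> = {G :: ('a \<times> real) set. subspace G \<and> (\<forall>(x, t)\<in>G. t \<le> k x)}"
  have "\<exists>M\<in>\<G>. \<forall>G\<in>\<G>. M \<subseteq> G \<longrightarrow> G = M"
  proof (rule subset_Zorn_nonempty)
    have "{0} \<in> \<G>"
      using k0 subspace_single_0 by (simp add: \<G>_def) (simp add: zero_prod_def)
    then show "\<G> \<noteq> {}" by blast
  next
    fix \<C> assume ne: "\<C> \<noteq> {}" and ch: "subset.chain \<G> \<C>"
    then have sub: "\<And>G. G \<in> \<C> \<Longrightarrow> subspace G" and le: "\<And>G x t. G \<in> \<C> \<Longrightarrow> (x, t) \<in> G \<Longrightarrow> t \<le> k x"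
      and tot: "\<And>G H. G \<in> \<C> \<Longrightarrow> H \<in> \<C> \<Longrightarrow> G \<subseteq> H \<or> H \<subseteq> G"
      by (auto simp: \<G>_def subset_chain_def)
    have "subspace (\<Union>\<C>)"
      unfolding subspace_def
    proof (intro conjI ballI allI)
      show "0 \<in> \<Union>\<C>" using ne sub subspace_0 by blast
    next
      fix x y assume "x \<in> \<Union>\<C>" "y \<in> \<Union>\<C>"
      then obtain G H where "G \<in> \<C>" "H \<in> \<C>" "x \<in> G" "y \<in> H" by blast
      then show "x + y \<in> \<Union>\<C>"
        using tot[of G H] sub subspace_add by blast
    next
      fix c :: real and x assume "x \<in> \<Union>\<C>"
      then show "c *\<^sub>R x \<in> \<Union>\<C>" using sub subspace_scale by blast
    qed
    then show "\<Union>\<C> \<in> \<G>" using le by (auto simp: \<G>_def)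
  qed
  then obtain M where M: "M \<in> \<G>" and max: "\<And>G. G \<in> \<G> \<Longrightarrow> M \<subseteq> G \<Longrightarrow> G = M" by blast
  have sM: "subspace M" and leM: "\<And>x t. (x, t) \<in> M \<Longrightarrow> t \<le> k x"
    using M by (auto simp: \<G>_def)
  have dom: "\<exists>t. (x0, t) \<in> M" for x0
  proof -
    \<comment> \<open>A value \<open>a\<close> at \<open>x0\<close> is admissible iff it is at least every element of \<open>L\<close> (from the constraints at
      \<open>y - s *\<^sub>R x0\<close>) and at most every quotient coming from the points \<open>y + s *\<^sub>R x0\<close>.\<close>
    define L where "L = {(t - k (y - s *\<^sub>R x0)) / s | y t s. (y, t) \<in> M \<and> s > 0}"
    have LU: "(t - k (y - s *\<^sub>R x0)) / s \<le> (k (y' + s' *\<^sub>R x0) - t') / s'"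
      if "(y, t) \<in> M" "s > 0" "(y', t') \<in> M" "s' > 0" for y t s y' t' s'
    proof -
      \<comment> \<open>With these weights the multiples of \<open>x0\<close> cancel, so that the convex combination of the two
        points lies over the domain of \<open>M\<close>.\<close>
      let ?u = "s / (s + s')" and ?v = "s' / (s + s')"
      have uv: "?u \<ge> 0" "?v \<ge> 0" "?u + ?v = 1"
        using that by (auto simp flip: add_divide_distrib)
      have "?u *\<^sub>R (y', t') + ?v *\<^sub>R (y, t) \<in> M"
        using sM that by (intro subspace_add subspace_scale)
      then have "?u * t' + ?v * t \<le> k (?u *\<^sub>R y' + ?v *\<^sub>R y)"
        by (intro leM) simp
      also have "?u *\<^sub>R y' + ?v *\<^sub>R y = ?u *\<^sub>R (y' + s' *\<^sub>R x0) + ?v *\<^sub>R (y - s *\<^sub>R x0)"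
        by (simp add: algebra_simps)
      also have "k \<dots> \<le> ?u * k (y' + s' *\<^sub>R x0) + ?v * k (y - s *\<^sub>R x0)"
        using cvx uv unfolding convex_on_def by blast
      finally have "(s + s') * (?u * t' + ?v * t) \<le> (s + s') * (?u * k (y' + s' *\<^sub>R x0) + ?v * k (y - s *\<^sub>R x0))"
        using that by (intro mult_left_mono) auto
      moreover have "(s + s') * (?u * a + ?v * b) = s * a + s' * b" for a b
      proof -
        have "(s + s') * ?u = s" "(s + s') * ?v = s'" using that by auto
        then show ?thesis by (metis distrib_left mult.assoc)
      qed
      ultimately have "s * t' + s' * t \<le> s * k (y' + s' *\<^sub>R x0) + s' * k (y - s *\<^sub>R x0)"
        by simp
      then show ?thesis using that by (simp add: field_simps)
    qed
    have "(0, 0) \<in> M" using subspace_0[OF sM] by (simp add: zero_prod_def)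
    have Lne: "L \<noteq> {}"
      unfolding L_def using \<open>(0, 0) \<in> M\<close> zero_less_one by blast
    have Lbdd: "bdd_above L"
    proof (rule bdd_aboveI)
      fix l assume "l \<in> L"
      then obtain y t s where l: "l = (t - k (y - s *\<^sub>R x0)) / s" "(y, t) \<in> M" "s > 0"
        unfolding L_def by blast
      show "l \<le> (k (0 + 1 *\<^sub>R x0) - 0) / 1"
        unfolding l(1) by (rule LU[OF l(2,3) \<open>(0, 0) \<in> M\<close> zero_less_one])
    qed
    define a where "a = Sup L"
    have lo: "(t - k (y - s *\<^sub>R x0)) / s \<le> a" if "(y, t) \<in> M" "s > 0" for y t s
      unfolding a_def by (rule cSup_upper[OF _ Lbdd]) (use that in \<open>auto simp: L_def\<close>)
    have hi: "a \<le> (k (y + s *\<^sub>R x0) - t) / s" if "(y, t) \<in> M" "s > 0" for y t s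
      unfolding a_def by (rule cSup_least[OF Lne]) (use that LU in \<open>auto simp: L_def\<close>)
    have "span (insert (x0, a) M) \<in> \<G>"
      unfolding \<G>_def
    proof (clarsimp)
      fix x t assume "(x, t) \<in> span (insert (x0, a) M)"
      then obtain c where "(x, t) - c *\<^sub>R (x0, a) \<in> M"
        by (metis span_breakdown_eq span_eq_iff sM)
      then have m: "(x - c *\<^sub>R x0, t - c * a) \<in> M" by simp
      consider "c = 0" | "c > 0" | "c < 0" by linarith
      then show "t \<le> k x"
      proof cases
        case 1 then show ?thesis using leM m by simp
      next
        case 2 then show ?thesis using hi[OF m, of c] by (simp add: field_simps)
      next
        case 3 then show ?thesis using lo[OF m, of "- c"] by (simp add: field_simps)
      qed
    qed
    then have "span (insert (x0, a) M) = M"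
      using max span_superset[of "insert (x0, a) M"] by simp
    then have "(x0, a) \<in> M" using span_base[of "(x0, a)" "insert (x0, a) M"] by simp
    then show ?thesis by blast
  qed
  have sing: "t = t'" if "(x, t) \<in> M" "(x, t') \<in> M" for x t t'
  proof (rule ccontr)
    assume ne: "t \<noteq> t'"
    \<comment> \<open>Scaled so that the vertical vector over \<open>0\<close> reaches the height \<open>k 0 + 1\<close>.\<close>
    let ?c = "(k 0 + 1) / (t - t')"
    have "?c *\<^sub>R ((x, t) - (x, t')) \<in> M"
      using sM that by (intro subspace_scale subspace_diff)
    then have "?c * (t - t') \<le> k 0" by (intro leM) (simp add: zero_prod_def)
    then show False using ne by simp
  qed
  obtain g where g: "\<And>x. (x, g x) \<in> M" using dom by metis
  have "linear g"
  proof
    fix x y and c :: real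
    show "g (x + y) = g x + g y"
      by (rule sing[OF g]) (use subspace_add[OF sM g[of x] g[of y]] in simp)
    show "g (c *\<^sub>R x) = c *\<^sub>R g x"
      by (rule sing[OF g]) (use subspace_scale[OF sM g[of x], of c] in simp)
  qed
  then show ?thesis using g leM by blast
qed

text \<open>The two requirements on \<open>g\<close> together say that \<open>g\<close> lies below \<open>k d = (INF c\<in>K. \<psi> (d + c))\<close>: one direction
  is \<open>g d \<le> g (d + c) \<le> \<psi> (d + c)\<close>, and conversely \<open>k \<le> \<psi>\<close> and \<open>k (- c) \<le> \<psi> 0 = 0\<close>.  So it suffices to apply
  \<open>convex_dominates_linear\<close> to \<open>k\<close>, which is convex, and finite by the convexity of \<open>\<psi>\<close> and its
  nonnegativity on \<open>K\<close>.  Continuity of \<open>\<psi>\<close> at \<open>0\<close> bounds \<open>g\<close> above near \<open>0\<close>, hence makes it bounded.\<close>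

lemma convex_sandwich_cone:
  fixes \<psi> :: "'a::real_normed_vector \<Rightarrow> real"
  assumes cvx: "convex_on UNIV \<psi>" and cont: "isCont \<psi> 0" and \<psi>0: "\<psi> 0 = 0"
    and K: "convex K" "cone K" "0 \<in> K" and pos: "\<And>c. c \<in> K \<Longrightarrow> 0 \<le> \<psi> c"
  shows "\<exists>g :: 'a \<Rightarrow>\<^sub>L real. (\<forall>d. blinfun_apply g d \<le> \<psi> d) \<and> (\<forall>c\<in>K. 0 \<le> blinfun_apply g c)"
proof -
  have add: "c + c' \<in> K" if "c \<in> K" "c' \<in> K" for c c'
    using K that convex_cone by blast
  have scale: "a *\<^sub>R c \<in> K" if "c \<in> K" "a \<ge> 0" for a c
    using K that by (auto simp: cone_def)
  have conv: "\<psi> (u *\<^sub>R x + v *\<^sub>R y) \<le> u * \<psi> x + v * \<psi> y" if "0 \<le> u" "0 \<le> v" "u + v = 1" for u v x y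
    using cvx that by (simp add: convex_on_def)
  define k where "k d = (INF c\<in>K. \<psi> (d + c))" for d
  have low: "- \<psi> (- d) \<le> \<psi> (d + c)" if "c \<in> K" for d c
  proof -
    have "0 \<le> \<psi> ((1/2) *\<^sub>R c)" using that by (intro pos scale) auto
    also have "(1/2) *\<^sub>R c = (1/2) *\<^sub>R (d + c) + (1/2) *\<^sub>R (- d)" by (simp add: algebra_simps)
    also have "\<psi> \<dots> \<le> (1/2) * \<psi> (d + c) + (1/2) * \<psi> (- d)"
      by (rule conv) auto
    finally show ?thesis by simp
  qed
  then have bdd: "bdd_below ((\<lambda>c. \<psi> (d + c)) ` K)" for d by (auto intro!: bdd_belowI2)
  have k_le: "k d \<le> \<psi> (d + c)" if "c \<in> K" for d c
    unfolding k_def by (rule cINF_lower[OF bdd that])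
  have "convex_on UNIV k"
  proof (rule convex_onI)
    fix t :: real and x y :: 'a assume t: "0 < t" "t < 1"
    show "k ((1 - t) *\<^sub>R x + t *\<^sub>R y) \<le> (1 - t) * k x + t * k y"
    proof (rule field_le_epsilon)
      fix e :: real assume e: "0 < e"
      have "\<exists>c\<in>K. \<psi> (d + c) < k d + e" for d
        using cINF_less_iff[OF _ bdd, of d "k d + e"] K e by (auto simp: k_def)
      then obtain c c' where c: "c \<in> K" "\<psi> (x + c) < k x + e" "c' \<in> K" "\<psi> (y + c') < k y + e"
        by meson
      have "k ((1 - t) *\<^sub>R x + t *\<^sub>R y) \<le> \<psi> (((1 - t) *\<^sub>R x + t *\<^sub>R y) + ((1 - t) *\<^sub>R c + t *\<^sub>R c'))"
        using c t by (intro k_le add scale) auto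
      also have "((1 - t) *\<^sub>R x + t *\<^sub>R y) + ((1 - t) *\<^sub>R c + t *\<^sub>R c') = (1 - t) *\<^sub>R (x + c) + t *\<^sub>R (y + c')"
        by (simp add: algebra_simps)
      also have "\<psi> \<dots> \<le> (1 - t) * \<psi> (x + c) + t * \<psi> (y + c')"
        using t by (intro conv) auto
      also have "\<dots> \<le> (1 - t) * (k x + e) + t * (k y + e)"
        using c t by (intro add_mono mult_left_mono) auto
      finally show "k ((1 - t) *\<^sub>R x + t *\<^sub>R y) \<le> (1 - t) * k x + t * k y + e"
        by (simp add: algebra_simps)
    qed
  qed simp
  moreover have "0 \<le> k 0"
    unfolding k_def using K pos by (intro cINF_greatest) auto
  ultimately obtain g where lin: "linear g" and g: "\<And>x. g x \<le> k x"
    using convex_dominates_linear by blast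
  have g_le: "g d \<le> \<psi> d" for d using g[of d] k_le[OF \<open>0 \<in> K\<close>, of d] by simp
  have g_pos: "0 \<le> g c" if "c \<in> K" for c
    using g[of "- c"] k_le[OF that, of "- c"] \<psi>0 linear_neg[OF lin, of c] by simp
  obtain \<delta> where \<delta>: "\<delta> > 0" "\<And>x. norm x < \<delta> \<Longrightarrow> \<psi> x < 1"
  proof -
    obtain \<delta> where "\<delta> > 0" "\<And>x. dist x 0 < \<delta> \<Longrightarrow> dist (\<psi> x) (\<psi> 0) < 1"
      using cont unfolding continuous_at_eps_delta by (meson zero_less_one)
    then show thesis using that[of \<delta>] \<psi>0 by (force simp: dist_real_def)
  qed
  have "bounded_linear g"
  proof (rule bounded_linear_intro)
    show "g (x + y) = g x + g y" "g (r *\<^sub>R x) = r *\<^sub>R g x" for x y r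
      using lin by (simp_all add: linear_add linear_scale)
    have one: "g x \<le> norm x * (2 / \<delta>)" for x
    proof (cases "x = 0")
      case True then show ?thesis using lin by (simp add: linear_0)
    next
      case False
      have "g ((\<delta> / (2 * norm x)) *\<^sub>R x) < 1"
        using g_le \<delta> False by (intro le_less_trans[OF g_le] \<delta>) simp
      then show ?thesis using False \<delta> lin by (simp add: linear_scale field_simps)
    qed
    show "norm (g x) \<le> norm x * (2 / \<delta>)" for x
      using one[of x] one[of "- x"] lin by (auto simp: linear_neg abs_le_iff)
  qed
  then have "blinfun_apply (Blinfun g) = g" by (rule bounded_linear_Blinfun_apply)
  then show ?thesis using g_le g_pos by (intro exI[of _ "Blinfun g"]) auto
qed

section \<open>A variational principle\<close>

text \<open>A form of the variational principle of Ekeland and Caristi.  The sets \<open>S x\<close> of points reachable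
  from \<open>x\<close> at cost paid for by the decrease of \<open>f\<close> are closed and shrink along reachability.  Choosing each
  next point almost minimal for \<open>f\<close> on the current set forces the diameters to \<open>0\<close>; from the common point
  \<open>a\<close> nothing but \<open>a\<close> itself is reachable, so the descent hypothesis leaves only \<open>f a = 0\<close>.\<close>

lemma descent_reaches_zero:
  fixes f :: "'a::complete_space \<Rightarrow> real"
  assumes pos: "\<And>x. 0 \<le> f x" and lsc: "\<And>t. open {x. t < f x}" and c: "c > 0"
    and descent: "\<And>x. 0 < f x \<Longrightarrow> f x \<le> f x0 \<Longrightarrow> \<exists>u. u \<noteq> x \<and> f u + c * dist u x \<le> f x"
  shows "\<exists>x. f x = 0 \<and> c * dist x x0 \<le> f x0"
proof -
  define S where "S x = {u. f u + c * dist u x \<le> f x}" for x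
  have self: "x \<in> S x" for x by (simp add: S_def)
  have trans: "S u \<subseteq> S x" if "u \<in> S x" for u x
  proof
    fix w assume "w \<in> S u"
    moreover have "c * dist w x \<le> c * (dist w u + dist u x)"
      using c by (intro mult_left_mono dist_triangle) auto
    ultimately show "w \<in> S x" using that by (simp add: S_def algebra_simps)
  qed
  have clo: "closed (S x)" for x
  proof -
    have "- S x = (\<Union>t. {u. t < f u} \<inter> {u. f x - c * dist u x < t})"
    proof (intro equalityI subsetI)
      fix u assume "u \<in> - S x"
      then have "f x - c * dist u x < f u" by (simp add: S_def)
      then show "u \<in> (\<Union>t. {u. t < f u} \<inter> {u. f x - c * dist u x < t})"
        using dense by blast
    qed (auto simp: S_def)
    moreover have "open {u. f x - c * dist u x < t}" for t
      by (intro open_Collect_less continuous_intros)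
    ultimately show ?thesis
      unfolding closed_def using lsc by (simp add: open_UN open_Int)
  qed
  have near: "\<exists>u\<in>S x. \<forall>w\<in>S x. f u \<le> f w + e" if e: "e > 0" for x e
  proof -
    have bdd: "bdd_below (f ` S x)" using pos by (auto intro!: bdd_belowI2)
    have "S x \<noteq> {}" using self by blast
    then obtain u where "u \<in> S x" "f u < (INF w\<in>S x. f w) + e"
      using cINF_less_iff[OF _ bdd, of "(INF w\<in>S x. f w) + e"] e by auto
    moreover have "(INF w\<in>S x. f w) \<le> f w" if "w \<in> S x" for w
      by (rule cINF_lower[OF bdd that])
    ultimately show ?thesis by (smt (verit))
  qed
  define nxt where "nxt n x = (SOME u. u \<in> S x \<and> (\<forall>w\<in>S x. f u \<le> f w + (1/2) ^ n))" for n x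
  have nxt: "nxt n x \<in> S x" "w \<in> S x \<Longrightarrow> f (nxt n x) \<le> f w + (1/2) ^ n" for n x w
    using someI_ex[of "\<lambda>u. u \<in> S x \<and> (\<forall>w\<in>S x. f u \<le> f w + (1/2) ^ n)"] near[of "(1/2)^n" x]
    unfolding nxt_def by fastforce+
  define X where "X = rec_nat x0 nxt"
  have X0: "X 0 = x0" and XS: "X (Suc n) = nxt n (X n)" for n by (simp_all add: X_def)
  have dec: "S (X n) \<subseteq> S (X m)" if "m \<le> n" for m n
    using that
  proof (induction rule: dec_induct)
    case (step n)
    then show ?case using trans[OF nxt(1)[of n "X n"]] by (simp add: XS)
  qed simp
  have small: "c * dist w (X (Suc n)) \<le> (1/2) ^ n" if "w \<in> S (X (Suc n))" for w n
  proof -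
    have "w \<in> S (X n)" using dec[of n "Suc n"] that by auto
    then show ?thesis using nxt(2)[of w "X n" n] that by (simp add: S_def XS)
  qed
  have "\<exists>a. \<Inter> (range (\<lambda>n. S (X n))) = {a}"
  proof (rule decreasing_closed_nest_sing)
    fix e :: real assume "e > 0"
    then obtain n where n: "(1/2) ^ n < c * e / 2"
      using c real_arch_pow_inv[of "c * e / 2" "1/2"] by auto
    show "\<exists>n. \<forall>x\<in>S (X n). \<forall>y\<in>S (X n). dist x y < e"
    proof (intro exI ballI)
      fix x y assume xy: "x \<in> S (X (Suc n))" "y \<in> S (X (Suc n))"
      have "c * dist x y \<le> c * (dist x (X (Suc n)) + dist y (X (Suc n)))"
        using c by (intro mult_left_mono dist_triangle2) auto
      also have "\<dots> < c * e" using small[OF xy(1)] small[OF xy(2)] n by (simp add: algebra_simps)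
      finally show "dist x y < e" using c by simp
    qed
  next
    show "S (X n) \<noteq> {}" for n using self by blast
  qed (use clo dec in auto)
  then obtain a where a: "\<Inter> (range (\<lambda>n. S (X n))) = {a}" by blast
  then have aS: "a \<in> S (X n)" for n by blast
  then have a0: "f a + c * dist a x0 \<le> f x0" using aS[of 0] by (simp add: S_def X0)
  have "f a = 0"
  proof (rule ccontr)
    assume "f a \<noteq> 0"
    moreover have "f a \<le> f x0"
      using a0 c zero_le_dist[of a x0] by (smt (verit) mult_nonneg_nonneg)
    ultimately obtain u where u: "u \<noteq> a" "u \<in> S a"
      using descent[of a] pos[of a] by (auto simp: S_def)
    then have "u \<in> \<Inter> (range (\<lambda>n. S (X n)))" using trans aS by blast
    then show False using a u by blast
  qed
  then show ?thesis using a0 by auto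
qed

section \<open>The excess over a convex cone\<close>

text \<open>Moving away from \<open>C\<close> along the ray from a near-closest point \<open>c\<close> through \<open>a\<close> increases the distance to
  \<open>C\<close> almost as fast as possible, because by convexity the distance grows at least proportionally
  to the distance from \<open>c\<close>.\<close>

lemma infdist_grows_outward:
  fixes C :: "'a::real_normed_vector set"
  assumes C: "convex C" "C \<noteq> {}" and a: "infdist a C > 0" and \<rho>: "\<rho> > 0" and b: "b < infdist a C + \<rho>"
  shows "\<exists>y. dist y a \<le> \<rho> \<and> b < infdist y C"
proof -
  define D where "D = infdist a C"
  have D: "D > 0" using a by (simp add: D_def)
  \<comment> \<open>The condition on \<open>c\<close> is \<open>b < (1 + \<rho> / dist a c) * D\<close>, the lower bound on the distance obtained
    after moving by \<open>\<rho>\<close> along the ray from \<open>c\<close>.\<close>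
  have "\<exists>c\<in>C. (b - D) * dist a c < \<rho> * D"
  proof (cases "b \<le> D")
    case True
    obtain c where "c \<in> C" using C by blast
    moreover have "(b - D) * dist a c \<le> 0" using True by (simp add: mult_nonpos_nonneg)
    moreover have "0 < \<rho> * D" using \<rho> D by simp
    ultimately show ?thesis by (intro bexI[of _ c]) linarith+
  next
    case False
    then have "D < \<rho> * D / (b - D)" using b D mult_strict_left_mono[of "b - D" \<rho> D] by (simp add: D_def field_simps)
    then have "(INF c\<in>C. dist a c) < \<rho> * D / (b - D)" using C by (simp add: D_def infdist_def)
    then obtain c where "c \<in> C" "dist a c < \<rho> * D / (b - D)"
      using cINF_less_iff[of C "dist a"] C by auto
    then show ?thesis using False by (intro bexI[of _ c]) (auto simp: field_simps)
  qed
  then obtain c where c: "c \<in> C" "(b - D) * dist a c < \<rho> * D" by blast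
  define N where "N = dist a c"
  have N: "N \<ge> D" "N > 0" using c D infdist_le[of c C a] by (auto simp: N_def D_def)
  define t where "t = 1 + \<rho> / N"
  define y where "y = c + t *\<^sub>R (a - c)"
  have t: "t > 1" using \<rho> N by (simp add: t_def)
  have "y - a = (\<rho> / N) *\<^sub>R (a - c)" by (simp add: y_def t_def algebra_simps)
  then have "dist y a = \<rho>" using \<rho> N by (simp add: dist_norm N_def)
  moreover have "t * D \<le> infdist y C"
    unfolding infdist_notempty[OF C(2)]
  proof (rule cINF_greatest[OF C(2)])
    fix c' assume c': "c' \<in> C"
    have "(1 - 1 / t) *\<^sub>R c + (1 / t) *\<^sub>R c' \<in> C"
      using C c c' t by (intro convexD) auto
    then have "D \<le> dist a ((1 - 1 / t) *\<^sub>R c + (1 / t) *\<^sub>R c')"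
      unfolding D_def by (rule infdist_le)
    also have "a = (1 - 1 / t) *\<^sub>R c + (1 / t) *\<^sub>R y"
      using t by (simp add: y_def algebra_simps)
    also have "dist \<dots> ((1 - 1 / t) *\<^sub>R c + (1 / t) *\<^sub>R c') = dist y c' / t"
      using t by (simp add: dist_norm flip: scaleR_diff_right)
    finally show "t * D \<le> dist y c'" using t by (simp add: field_simps)
  qed
  moreover have "b < t * D" using c(2) N by (simp add: t_def N_def[symmetric] field_simps)
  ultimately show ?thesis by (intro exI[of _ y]) auto
qed

lemma infdist_le_excess: "a \<in> A \<Longrightarrow> ereal (infdist a C) \<le> excess A C"
  unfolding excess_def by (rule SUP_upper)

lemma excess_nonneg: "A \<noteq> {} \<Longrightarrow> 0 \<le> excess A C"
  using infdist_le_excess[of _ A C] infdist_nonneg[of _ C]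
  by (metis ereal_less_eq(5) ex_in_conv order_trans)

lemma excess_le_0_iff:
  assumes "closed C" "C \<noteq> {}"
  shows "excess A C \<le> 0 \<longleftrightarrow> A \<subseteq> C"
proof -
  have "excess A C \<le> 0 \<longleftrightarrow> (\<forall>a\<in>A. infdist a C \<le> 0)"
    by (simp add: excess_def SUP_le_iff)
  also have "\<dots> \<longleftrightarrow> A \<subseteq> C"
    using assms in_closed_iff_infdist_zero infdist_nonneg by (metis antisym subset_iff order_refl)
  finally show ?thesis .
qed

lemma excess_eq_0_iff:
  assumes "closed C" "C \<noteq> {}" "A \<noteq> {}"
  shows "excess A C = 0 \<longleftrightarrow> A \<subseteq> C"
  using excess_le_0_iff[OF assms(1,2), of A] excess_nonneg[OF assms(3), of C] by force

text \<open>The excess inherits lower semicontinuity from the set-valued map: a point of \<open>G x\<close> at distance more than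
  \<open>t\<close> from \<open>C\<close> survives, approximately, in \<open>G u\<close> for \<open>u\<close> near \<open>x\<close>.\<close>

lemma open_excess_greater:
  assumes "lsc_multimap G"
  shows "open {x. t < excess (G x) C}"
proof (subst open_subopen, clarify)
  fix x assume "t < excess (G x) C"
  then obtain a where a: "a \<in> G x" "t < ereal (infdist a C)"
    by (auto simp: excess_def less_SUP_iff)
  have "open {y. t < ereal (infdist y C)}"
    by (intro open_Collect_less continuous_intros)
  moreover have "G x \<inter> {y. t < ereal (infdist y C)} \<noteq> {}" using a by blast
  ultimately obtain U where "open U" "x \<in> U" "\<And>u. u \<in> U \<Longrightarrow> G u \<inter> {y. t < ereal (infdist y C)} \<noteq> {}"
    using assms unfolding lsc_multimap_def by meson
  moreover have "t < excess (G u) C" if "G u \<inter> {y. t < ereal (infdist y C)} \<noteq> {}" for u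
  proof -
    from that obtain b where "b \<in> G u" "t < ereal (infdist b C)" by blast
    then show ?thesis using infdist_le_excess less_le_trans by blast
  qed
  ultimately show "\<exists>T. open T \<and> x \<in> T \<and> T \<subseteq> {x. t < excess (G x) C}"
    by (intro exI[of _ U]) auto
qed

text \<open>The \<open>C\<close>-increase property compares the excess of two enlargements.  On the right, adding \<open>C\<close> does not
  increase the excess, so points of \<open>enlargement (G x + C) r\<close> are within \<open>E + r\<close> of \<open>C\<close>.  On the left,
  \<open>infdist_grows_outward\<close> shows that enlarging by \<open>\<beta> * r\<close> raises the distance of each point of \<open>G u\<close> outside
  \<open>C\<close> by \<open>\<beta> * r\<close>.  The latter says nothing if \<open>G u \<subseteq> C\<close>; lower semicontinuity excludes this for
  small \<open>r\<close>.\<close>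

lemma excess_descent:
  fixes G :: "'x::metric_space \<Rightarrow> 'y::real_normed_vector set"
  assumes C: "convex C" "cone C" "C \<noteq> {}"
    and lsc: "lsc_multimap G" and \<alpha>: "1 < \<alpha>" "ereal \<alpha> < inc C G x"
    and E: "excess (G x) C = ereal E" "0 < E"
  shows "\<exists>u. u \<noteq> x \<and> excess (G u) C + ereal ((\<alpha> - 1) * dist u x) \<le> ereal E"
proof -
  obtain \<beta> \<delta> where \<beta>: "\<alpha> < \<beta>" and \<delta>: "\<delta> > 0"
    and inc: "\<And>r. 0 < r \<Longrightarrow> r \<le> \<delta> \<Longrightarrow> \<exists>u\<in>cball x r. enlargement (G u) (\<beta> * r) \<subseteq> enlargement (G x + C) r"
    using \<alpha>(2) unfolding inc_def less_Sup_iff by fastforce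
  have "x \<in> {u. 0 < excess (G u) C}" using E by simp
  then obtain \<eta> where \<eta>: "\<eta> > 0" "cball x \<eta> \<subseteq> {u. 0 < excess (G u) C}"
    using open_excess_greater[OF lsc, of 0 C] open_contains_cball by blast
  define r where "r = min \<delta> \<eta>"
  have r: "0 < r" using \<delta> \<eta> by (simp add: r_def)
  obtain u where u: "u \<in> cball x r" and encl: "enlargement (G u) (\<beta> * r) \<subseteq> enlargement (G x + C) r"
    using inc[of r] r by (auto simp: r_def)
  have upper: "infdist y C \<le> E + r" if "y \<in> enlargement (G x + C) r" for y
  proof (cases "G x = {}")
    case True
    then show ?thesis using E by (simp add: excess_def bot_ereal_def)
  next
    case False
    then have ne: "G x + C \<noteq> {}" using C by (auto simp: set_plus_def)
    have "infdist y C - E \<le> infdist y (G x + C)"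
      unfolding infdist_notempty[OF ne]
    proof (rule cINF_greatest[OF ne])
      fix w assume "w \<in> G x + C"
      then obtain v c where w: "w = v + c" "v \<in> G x" "c \<in> C" by (auto simp: set_plus_def)
      have "infdist w C \<le> infdist v C"
        unfolding infdist_notempty[OF C(3), of v]
      proof (rule cINF_greatest[OF C(3)])
        fix c' assume "c' \<in> C"
        then have "c' + c \<in> C" using C w convex_cone by blast
        then show "infdist w C \<le> dist v c'" by (rule infdist_le2) (simp add: w)
      qed
      also have "infdist v C \<le> E" using infdist_le_excess[OF w(2), of C] E by simp
      finally show "infdist y C - E \<le> dist y w" using infdist_triangle[of y C w] by simp
    qed
    then show ?thesis using that by (simp add: enlargement_def)
  qed
  have lower: "infdist a C + \<beta> * r \<le> E + r" if a: "a \<in> G u" "infdist a C > 0" for a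
  proof (rule ccontr)
    assume "\<not> ?thesis"
    then obtain y where y: "dist y a \<le> \<beta> * r" "E + r < infdist y C"
      using infdist_grows_outward[OF C(1,3) a(2), of "\<beta> * r" "E + r"] \<alpha> \<beta> r by auto
    have "y \<in> enlargement (G u) (\<beta> * r)"
      unfolding enlargement_def using infdist_le2[OF a(1) y(1)] by simp
    then show False using upper[of y] encl y by auto
  qed
  have "0 < excess (G u) C" using u \<eta> by (auto simp: r_def)
  then obtain a0 where a0: "a0 \<in> G u" "infdist a0 C > 0"
    by (auto simp: excess_def less_SUP_iff)
  have le: "excess (G u) C \<le> ereal (E - (\<beta> - 1) * r)"
    unfolding excess_def
  proof (rule SUP_least)
    fix a assume "a \<in> G u"
    then show "ereal (infdist a C) \<le> ereal (E - (\<beta> - 1) * r)"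
      using lower[of a] lower[OF a0] a0 infdist_nonneg[of a C]
      by (cases "infdist a C = 0") (auto simp: algebra_simps)
  qed
  have "u \<noteq> x"
  proof
    assume "u = x"
    then have "(\<beta> - 1) * r \<le> 0" using le E by simp
    then show False using \<alpha> \<beta> r mult_pos_pos[of "\<beta> - 1" r] by linarith
  qed
  moreover have "(\<alpha> - 1) * dist u x \<le> (\<beta> - 1) * r"
    using u \<alpha> \<beta> by (intro mult_mono) (auto simp: dist_commute)
  then have "ereal (E - (\<beta> - 1) * r) + ereal ((\<alpha> - 1) * dist u x) \<le> ereal E" by simp
  then have "excess (G u) C + ereal ((\<alpha> - 1) * dist u x) \<le> ereal E"
    using add_right_mono[OF le] order_trans by blast
  ultimately show ?thesis by blast
qed

section \<open>Geometry of the feasible set\<close>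

text \<open>\<open>excess_descent\<close> feeds \<open>descent_reaches_zero\<close>.  The latter is about real-valued functions, so the
  excess is truncated at \<open>E + 1\<close>; this preserves lower semicontinuity and changes nothing on the
  sublevel set of level \<open>E\<close>, to which the descent is confined.\<close>

lemma feasibility_error_bound:
  fixes G :: "'x::complete_space \<Rightarrow> 'y::real_normed_vector set"
  assumes C: "closed C" "convex C" "cone C" "C \<noteq> {}"
    and ne: "\<And>x. G x \<noteq> {}" and lsc: "lsc_multimap G"
    and \<alpha>: "1 < \<alpha>" "\<And>x. \<not> G x \<subseteq> C \<Longrightarrow> ereal \<alpha> < inc C G x"
    and fin: "excess (G x0) C < \<infinity>"
  shows "\<exists>x. G x \<subseteq> C \<and> ereal ((\<alpha> - 1) * dist x x0) \<le> excess (G x0) C"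
proof -
  let ?e = "\<lambda>x. excess (G x) C"
  obtain E where E: "?e x0 = ereal E"
    using fin excess_nonneg[OF ne, of x0 C] by (cases "?e x0") auto
  define f where "f x = real_of_ereal (min (?e x) (ereal (E + 1)))" for x
  have f: "ereal (f x) = min (?e x) (ereal (E + 1))" for x
    using excess_nonneg[OF ne, of x C] unfolding f_def by (cases "?e x") (auto simp: min_def)
  have fE: "f x0 = E" using f[of x0] by (simp add: E min_def)
  have f_eq: "?e x = ereal (f x)" if "?e x \<le> ereal E \<or> f x \<le> E" for x
    using f[of x] that by (cases "?e x") (auto simp: min_def split: if_splits)
  have "\<exists>x. f x = 0 \<and> (\<alpha> - 1) * dist x x0 \<le> f x0"
  proof (rule descent_reaches_zero)
    have E0: "0 \<le> E" using excess_nonneg[OF ne, of x0 C] E by simp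
    have "0 \<le> ereal (f x)" for x using excess_nonneg[OF ne, of x C] E0 by (simp add: f)
    then show "0 \<le> f x" for x by simp
    have "{x. t < f x} = (if t < E + 1 then {x. ereal t < ?e x} else {})" for t
    proof -
      have "t < f x \<longleftrightarrow> ereal t < ?e x \<and> t < E + 1" for x
        using f[of x] by (metis less_ereal.simps(1) min_less_iff_conj)
      then show ?thesis by auto
    qed
    then show "open {x. t < f x}" for t
      using open_excess_greater[OF lsc] by simp
    show "\<exists>u. u \<noteq> x \<and> f u + (\<alpha> - 1) * dist u x \<le> f x" if x: "0 < f x" "f x \<le> f x0" for x
    proof -
      have ex: "?e x = ereal (f x)" using f_eq x fE by simp
      then have "\<not> G x \<subseteq> C" using excess_le_0_iff[OF C(1,4), of "G x"] x by simp
      then obtain u where u: "u \<noteq> x" "?e u + ereal ((\<alpha> - 1) * dist u x) \<le> ereal (f x)"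
        using excess_descent[OF C(2-4) lsc \<alpha>(1) \<alpha>(2) ex x(1)] by blast
      have d: "0 \<le> (\<alpha> - 1) * dist u x" using \<alpha> by simp
      have "?e u \<le> ereal E"
        using u(2) d x(2) fE by (cases "?e u") auto
      then have "?e u = ereal (f u)" using f_eq by blast
      then show ?thesis using u by auto
    qed
  qed (use \<alpha> in simp)
  then obtain x where x: "f x = 0" "(\<alpha> - 1) * dist x x0 \<le> E" using fE by auto
  have "0 \<le> E" using excess_nonneg[OF ne, of x0 C] E by simp
  then have "?e x = 0" using f_eq[of x] x by (simp add: zero_ereal_def)
  then have "G x \<subseteq> C" using excess_le_0_iff[OF C(1,4), of "G x"] by simp
  then show ?thesis using x E by (intro exI[of _ x]) auto
qed

text \<open>If \<open>f\<close> is in the normal cone and \<open>s\<close> is a feasible point close to \<open>z\<close>, then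
  \<open>f (z - z0) \<le> f (z - s) \<le> norm f * dist s z\<close>, which the error bound estimates by a multiple of the excess at
  \<open>z\<close>.\<close>

lemma normal_cone_eq_cone_subdifferential_excess:
  fixes F :: "'z::real_normed_vector \<Rightarrow> 'y::real_normed_vector set"
  assumes C: "closed C" "C \<noteq> {}" and ne: "\<And>z. F z \<noteq> {}" and z0: "F z0 \<subseteq> C" and c: "c > 0"
    and bound: "\<And>z. excess (F z) C < \<infinity> \<Longrightarrow> \<exists>s. F s \<subseteq> C \<and> ereal (c * dist s z) \<le> excess (F z) C"
  shows "cone hull (subdifferential (\<lambda>z. excess (F z) C) z0) =
           {f :: 'z \<Rightarrow>\<^sub>L real. \<forall>s. F s \<subseteq> C \<longrightarrow> blinfun_apply f (s - z0) \<le> 0}"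
proof -
  have e0: "excess (F s) C = 0" if "F s \<subseteq> C" for s
    using excess_eq_0_iff[OF C ne] that by blast
  have sub: "g \<in> subdifferential (\<lambda>z. excess (F z) C) z0 \<longleftrightarrow>
      (\<forall>z. ereal (blinfun_apply g (z - z0)) \<le> excess (F z) C)" for g
    by (simp add: subdifferential_def e0[OF z0])
  show ?thesis
  proof (intro equalityI subsetI)
    fix f assume "f \<in> cone hull (subdifferential (\<lambda>z. excess (F z) C) z0)"
    then obtain t g where f: "f = t *\<^sub>R g" "0 \<le> t" "g \<in> subdifferential (\<lambda>z. excess (F z) C) z0"
      by (auto simp: cone_hull_expl)
    have "blinfun_apply g (s - z0) \<le> 0" if "F s \<subseteq> C" for s
      using f(3) e0[OF that] unfolding sub by (metis ereal_less_eq(4))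
    then show "f \<in> {f. \<forall>s. F s \<subseteq> C \<longrightarrow> blinfun_apply f (s - z0) \<le> 0}"
      using f by (auto simp: blinfun.scaleR_left intro: mult_nonneg_nonpos)
  next
    fix f :: "'z \<Rightarrow>\<^sub>L real" assume "f \<in> {f. \<forall>s. F s \<subseteq> C \<longrightarrow> blinfun_apply f (s - z0) \<le> 0}"
    then have f: "\<And>s. F s \<subseteq> C \<Longrightarrow> blinfun_apply f (s - z0) \<le> 0" by blast
    \<comment> \<open>The summand \<open>1\<close> keeps \<open>t\<close> positive when \<open>f = 0\<close>.\<close>
    define t where "t = (norm f + 1) / c"
    have t: "t > 0" using c by (simp add: t_def add_nonneg_pos)
    have "(1 / t) *\<^sub>R f \<in> subdifferential (\<lambda>z. excess (F z) C) z0"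
      unfolding sub
    proof
      fix z
      show "ereal (blinfun_apply ((1 / t) *\<^sub>R f) (z - z0)) \<le> excess (F z) C"
      proof (cases "excess (F z) C < \<infinity>")
        case True
        then obtain s where s: "F s \<subseteq> C" "ereal (c * dist s z) \<le> excess (F z) C" using bound by blast
        have "blinfun_apply f (z - z0) = blinfun_apply f (z - s) + blinfun_apply f (s - z0)"
          by (simp flip: blinfun.add_right)
        also have "\<dots> \<le> norm f * norm (z - s)"
          using f[OF s(1)] norm_blinfun[of f "z - s"] by simp
        also have "\<dots> \<le> (norm f + 1) * dist s z"
          by (simp add: dist_norm norm_minus_commute mult_right_mono)
        also have "\<dots> = t * (c * dist s z)" using c by (simp add: t_def)
        finally have "blinfun_apply ((1 / t) *\<^sub>R f) (z - z0) \<le> c * dist s z"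
          using t by (simp add: blinfun.scaleR_left field_simps)
        then show ?thesis using s(2) order_trans ereal_less_eq(3) by blast
      qed auto
    qed
    then have "t *\<^sub>R ((1 / t) *\<^sub>R f) \<in> cone hull (subdifferential (\<lambda>z. excess (F z) C) z0)"
      unfolding cone_hull_expl using t by (metis (mono_tags, lifting) less_imp_le mem_Collect_eq)
    then show "f \<in> cone hull (subdifferential (\<lambda>z. excess (F z) C) z0)" using t by simp
  qed
qed

lemma convex_feasible_set:
  fixes F :: "'z::real_vector \<Rightarrow> 'y::real_vector set"
  assumes C: "convex C" "cone C" and conc: "cone_concave C F"
  shows "convex {z. F z \<subseteq> C}" (is "convex ?S")
  unfolding convex_alt
proof (intro ballI allI impI)
  fix s1 s2 and u :: real assume s: "s1 \<in> ?S" "s2 \<in> ?S" and u: "0 \<le> u \<and> u \<le> 1"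
  have add: "a + b \<in> C" if "a \<in> C" "b \<in> C" for a b
    using that C convex_cone[of C] by simp
  have scale: "r *\<^sub>R a \<in> C" if "a \<in> C" "0 \<le> r" for r :: real and a
    using that C convex_cone[of C] by simp
  have "F ((1 - u) *\<^sub>R s1 + (1 - (1 - u)) *\<^sub>R s2)
      \<subseteq> (\<lambda>y. (1 - u) *\<^sub>R y) ` F s1 + (\<lambda>y. (1 - (1 - u)) *\<^sub>R y) ` F s2 + C"
    using conc[unfolded cone_concave_def, rule_format, of "1 - u" s1 s2] u by simp
  also have "\<dots> \<subseteq> C"
  proof
    fix w assume "w \<in> (\<lambda>y. (1 - u) *\<^sub>R y) ` F s1 + (\<lambda>y. (1 - (1 - u)) *\<^sub>R y) ` F s2 + C"
    then obtain y1 y2 y3 where "w = (1 - u) *\<^sub>R y1 + u *\<^sub>R y2 + y3" "y1 \<in> F s1" "y2 \<in> F s2" "y3 \<in> C"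
      by (auto simp: set_plus_def)
    moreover have "y1 \<in> C" "y2 \<in> C" using calculation s by auto
    ultimately show "w \<in> C" using u by (simp add: add scale)
  qed
  finally show "(1 - u) *\<^sub>R s1 + u *\<^sub>R s2 \<in> ?S" by simp
qed

section \<open>Sum rule for subgradients\<close>

text \<open>After translating \<open>z0\<close> to the origin and subtracting \<open>h\<close>, the function \<open>\<psi>\<close> is nonnegative on \<open>S - z0\<close>,
  hence, by convexity and \<open>\<psi> 0 = 0\<close>, on the generated cone \<open>K\<close>.  A functional below \<open>\<psi>\<close> that is nonnegative on \<open>K\<close>,
  provided by \<open>convex_sandwich_cone\<close>, is the required subgradient minus \<open>h\<close>.\<close>

lemma subgradient_sum_rule:
  fixes \<phi> :: "'a::real_normed_vector \<Rightarrow> real"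
  assumes cvx: "convex_on UNIV \<phi>" and cont: "isCont \<phi> z0"
    and S: "convex S" "z0 \<in> S"
    and h: "\<And>s. s \<in> S \<Longrightarrow> blinfun_apply h (s - z0) \<le> \<phi> s - \<phi> z0"
  shows "\<exists>g. (\<forall>z. blinfun_apply g (z - z0) \<le> \<phi> z - \<phi> z0) \<and>
             (\<forall>s\<in>S. blinfun_apply (h - g) (s - z0) \<le> 0)"
proof -
  define \<psi> where "\<psi> d = \<phi> (z0 + d) - \<phi> z0 - blinfun_apply h d" for d
  define K where "K = cone hull ((\<lambda>s. s - z0) ` S)"
  have conv: "\<psi> (u *\<^sub>R x + v *\<^sub>R y) \<le> u * \<psi> x + v * \<psi> y" if uv: "0 \<le> u" "0 \<le> v" "u + v = 1" for u v x y
  proof -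
    have "z0 + (u *\<^sub>R x + v *\<^sub>R y) = (u + v) *\<^sub>R z0 + (u *\<^sub>R x + v *\<^sub>R y)" using uv by simp
    also have "\<dots> = u *\<^sub>R (z0 + x) + v *\<^sub>R (z0 + y)" by (simp add: algebra_simps)
    finally have "\<phi> (z0 + (u *\<^sub>R x + v *\<^sub>R y)) \<le> u * \<phi> (z0 + x) + v * \<phi> (z0 + y)"
      using cvx uv by (simp add: convex_on_def)
    moreover have "\<phi> z0 = u * \<phi> z0 + v * \<phi> z0" using uv by (simp flip: distrib_right)
    ultimately show ?thesis
      by (simp add: \<psi>_def blinfun.add_right blinfun.scaleR_right algebra_simps)
  qed
  have \<psi>0: "\<psi> 0 = 0" by (simp add: \<psi>_def)
  have "\<exists>g :: 'a \<Rightarrow>\<^sub>L real. (\<forall>d. blinfun_apply g d \<le> \<psi> d) \<and> (\<forall>c\<in>K. 0 \<le> blinfun_apply g c)"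
  proof (rule convex_sandwich_cone)
    show "convex_on UNIV \<psi>" using conv by (simp add: convex_on_def)
    have "isCont (\<lambda>d. \<phi> (z0 + d)) 0"
      by (rule isCont_o2[where g = \<phi>]) (use cont in \<open>auto intro: continuous_intros\<close>)
    then show "isCont \<psi> 0" unfolding \<psi>_def by (intro continuous_intros)
    have "convex ((\<lambda>s. s - z0) ` S)" using S(1) by (simp add: convex_translation_subtract)
    then show "convex K" unfolding K_def by (rule convex_cone_hull)
    show "cone K" unfolding K_def by (rule cone_cone_hull)
    show "0 \<in> K" using S(2) unfolding K_def by (metis cone_hull_contains_0 empty_iff image_is_empty)
    fix d assume "d \<in> K"
    then obtain t s where d: "d = t *\<^sub>R (s - z0)" "0 \<le> t" "s \<in> S" by (auto simp: K_def cone_hull_expl)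
    have on_S: "0 \<le> \<psi> (w - z0)" if "w \<in> S" for w using h[OF that] by (simp add: \<psi>_def)
    show "0 \<le> \<psi> d"
    proof (cases "t \<le> 1")
      case True
      have "(1 - t) *\<^sub>R z0 + t *\<^sub>R s \<in> S" using S d True by (intro convexD) auto
      from on_S[OF this] show ?thesis by (simp add: d algebra_simps)
    next
      case False
      have "0 \<le> \<psi> (s - z0)" by (rule on_S[OF d(3)])
      also have "s - z0 = (1 / t) *\<^sub>R d + (1 - 1 / t) *\<^sub>R 0" using False by (simp add: d)
      also have "\<psi> \<dots> \<le> (1 / t) * \<psi> d + (1 - 1 / t) * \<psi> 0" using False by (intro conv) auto
      finally show ?thesis using False by (simp add: \<psi>0 zero_le_divide_iff)
    qed
  qed (rule \<psi>0)
  then obtain g :: "'a \<Rightarrow>\<^sub>L real" where g: "\<And>d. blinfun_apply g d \<le> \<psi> d" "\<And>c. c \<in> K \<Longrightarrow> 0 \<le> blinfun_apply g c"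
    by blast
  have "s - z0 \<in> K" if "s \<in> S" for s
    using that hull_subset[of "(\<lambda>s. s - z0) ` S" cone] by (auto simp: K_def)
  then show ?thesis
    using g(1)[of "_ - z0"] g(2)
    by (intro exI[of _ "h + g"]) (auto simp: \<psi>_def blinfun.add_left blinfun.minus_left algebra_simps)
qed

section \<open>Subgradients of the value function\<close>

lemma dual_pair_apply: "blinfun_apply (dual_pair f g) (p, x) = blinfun_apply f p + blinfun_apply g x"
  by (simp add: dual_pair_def blinfun.add_left)

lemma ex_dual_pair: "\<exists>f g. h = dual_pair f g"
proof -
  have 1: "bounded_linear (\<lambda>p. blinfun_apply h (p, 0))" "bounded_linear (\<lambda>x. blinfun_apply h (0, x))"
    by (auto intro!: bounded_linear_compose[OF blinfun.bounded_linear_right] bounded_linear_Pair bounded_linear_zero bounded_linear_ident)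
  have "h = dual_pair (Blinfun (\<lambda>p. blinfun_apply h (p, 0))) (Blinfun (\<lambda>x. blinfun_apply h (0, x)))"
    by (rule blinfun_eqI) (auto simp: dual_pair_apply bounded_linear_Blinfun_apply 1 simp flip: blinfun.add_right)
  then show ?thesis by blast
qed

lemma subdifferential_ereal_iff:
  "f \<in> subdifferential (\<lambda>z. ereal (\<phi> z)) z0 \<longleftrightarrow> (\<forall>z. blinfun_apply f (z - z0) \<le> \<phi> z - \<phi> z0)"
  by (simp add: subdifferential_def)

text \<open>At a minimiser the inequality \<open>f (p - pbar) \<le> val p - val pbar\<close> with the infimum \<open>val p\<close> unfolds into
  one inequality for each feasible \<open>x\<close>.\<close>

lemma subdifferential_optval_iff:
  assumes "xbar \<in> argmin_set \<phi> F C pbar"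
  shows "f \<in> subdifferential (optval \<phi> F C) pbar \<longleftrightarrow>
    (\<forall>s. F s \<subseteq> C \<longrightarrow> blinfun_apply (dual_pair f 0) (s - (pbar, xbar)) \<le> \<phi> s - \<phi> (pbar, xbar))"
proof -
  have val: "optval \<phi> F C pbar = ereal (\<phi> (pbar, xbar))"
    using assms by (simp add: argmin_set_def)
  have "f \<in> subdifferential (optval \<phi> F C) pbar \<longleftrightarrow>
      (\<forall>p. ereal (blinfun_apply f (p - pbar) + \<phi> (pbar, xbar)) \<le> optval \<phi> F C p)"
    unfolding subdifferential_def val
    by (simp add: ereal_le_minus_iff)
  also have "\<dots> \<longleftrightarrow> (\<forall>p x. F (p, x) \<subseteq> C \<longrightarrow> blinfun_apply f (p - pbar) + \<phi> (pbar, xbar) \<le> \<phi> (p, x))"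
    by (simp add: optval_def le_INF_iff feasible_def)
  finally show ?thesis by (auto simp: dual_pair_apply algebra_simps)
qed

theorem theorem3p6:
  fixes \<phi> :: "'p::banach \<times> 'x::banach \<Rightarrow> real"
    and F :: "'p \<times> 'x \<Rightarrow> 'y::banach set"
    and C :: "'y set"
    and pbar :: 'p and xbar :: 'x
  assumes "closed C" and "convex C" and "cone C"
    and "{0} \<subset> C" and "C \<subset> UNIV"
    and "\<And>z. F z \<noteq> {}" and "\<And>z. closed (F z)"
    and "qcsvi \<phi> F C"
    and "\<exists>p. optval \<phi> F C p \<noteq> -\<infinity>"
    and "xbar \<in> argmin_set \<phi> F C pbar"
    and "subtransversal_at (epigraph UNIV \<phi>) (graph_of (feasible F C) \<times> (UNIV :: real set))
           ((pbar, xbar), \<phi> (pbar, xbar))"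
  shows "subdifferential (optval \<phi> F C) pbar =
           {pstar + qstar | pstar qstar.
              \<exists>xstar. dual_pair pstar xstar \<in> subdifferential (\<lambda>z. ereal (\<phi> z)) (pbar, xbar) \<and>
                dual_pair qstar (- xstar)
                  \<in> cone hull (subdifferential (\<lambda>z. excess (F z) C) (pbar, xbar))}"
proof -
  let ?z = "(pbar, xbar)"
  define S where "S = {s. F s \<subseteq> C}"
  have Cne: "C \<noteq> {}" using assms(4) by blast
  have cvx: "convex_on UNIV \<phi>" and cont: "continuous_on UNIV \<phi>"
    and lsc: "\<And>p. lsc_multimap (\<lambda>x. F (p, x))" and conc: "cone_concave C F"
    and incb: "1 < inc_bound C F"
    using assms(8) by (auto simp: qcsvi_def)
  have z: "F ?z \<subseteq> C" using assms(10) by (simp add: argmin_set_def feasible_def)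
  have "convex S"
    unfolding S_def using assms(2,3) conc by (rule convex_feasible_set)
  obtain \<alpha> where \<alpha>: "1 < \<alpha>" "ereal \<alpha> < inc_bound C F"
    using ereal_dense2[OF incb] by auto
  have inc: "ereal \<alpha> < inc C (\<lambda>x. F (p, x)) x" if "\<not> F (p, x) \<subseteq> C" for p x
  proof (rule less_le_trans[OF \<alpha>(2)])
    show "inc_bound C F \<le> inc C (\<lambda>x. F (p, x)) x"
      unfolding inc_bound_def by (rule Inf_lower) (use that in blast)
  qed
  have bound: "\<exists>s. F s \<subseteq> C \<and> ereal ((\<alpha> - 1) * dist s z) \<le> excess (F z) C"
    if fin: "excess (F z) C < \<infinity>" for z
  proof -
    obtain p x where zpx: "z = (p, x)" by (cases z)
    obtain x' where "F (p, x') \<subseteq> C" "ereal ((\<alpha> - 1) * dist x' x) \<le> excess (F (p, x)) C"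
      using feasibility_error_bound[OF assms(1-3) Cne assms(6) lsc \<alpha>(1) inc, of p x] fin zpx by auto
    then show ?thesis
      by (intro exI[of _ "(p, x')"]) (simp add: zpx dist_Pair_Pair)
  qed
  have normal: "cone hull (subdifferential (\<lambda>z. excess (F z) C) ?z) =
      {f. \<forall>s\<in>S. blinfun_apply f (s - ?z) \<le> 0}"
    using normal_cone_eq_cone_subdifferential_excess[OF assms(1) Cne assms(6) z _ bound] \<alpha>(1)
    by (simp add: S_def)
  show ?thesis
    unfolding normal
  proof (intro equalityI subsetI)
    fix f assume "f \<in> subdifferential (optval \<phi> F C) pbar"
    then have supp: "blinfun_apply (dual_pair f 0) (s - ?z) \<le> \<phi> s - \<phi> ?z" if "s \<in> S" for s
      using that subdifferential_optval_iff[OF assms(10)] by (simp add: S_def del: split_paired_All)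
    have "isCont \<phi> ?z" "?z \<in> S"
      using cont z by (simp_all add: S_def continuous_on_eq_continuous_at)
    then obtain g where g: "\<And>z. blinfun_apply g (z - ?z) \<le> \<phi> z - \<phi> ?z"
        "\<And>s. s \<in> S \<Longrightarrow> blinfun_apply (dual_pair f 0 - g) (s - ?z) \<le> 0"
      using subgradient_sum_rule[OF cvx _ \<open>convex S\<close> _ supp] by blast
    obtain pstar xstar where gp: "g = dual_pair pstar xstar" using ex_dual_pair by blast
    have "dual_pair f 0 - g = dual_pair (f - pstar) (- xstar)"
      by (rule blinfun_eqI) (auto simp: gp dual_pair_apply blinfun.diff_left blinfun.minus_left)
    then show "f \<in> {pstar + qstar | pstar qstar.
              \<exists>xstar. dual_pair pstar xstar \<in> subdifferential (\<lambda>z. ereal (\<phi> z)) ?z \<and>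
                dual_pair qstar (- xstar) \<in> {f. \<forall>s\<in>S. blinfun_apply f (s - ?z) \<le> 0}}"
      using g gp
      by (intro CollectI exI[of _ pstar] exI[of _ "f - pstar"] conjI exI[of _ xstar])
        (simp_all add: subdifferential_ereal_iff del: split_paired_All)
  next
    fix f assume "f \<in> {pstar + qstar | pstar qstar.
              \<exists>xstar. dual_pair pstar xstar \<in> subdifferential (\<lambda>z. ereal (\<phi> z)) ?z \<and>
                dual_pair qstar (- xstar) \<in> {f. \<forall>s\<in>S. blinfun_apply f (s - ?z) \<le> 0}}"
    then obtain pstar qstar xstar where f: "f = pstar + qstar"
      and sub: "\<And>z. blinfun_apply (dual_pair pstar xstar) (z - ?z) \<le> \<phi> z - \<phi> ?z"
      and nrm: "\<And>s. s \<in> S \<Longrightarrow> blinfun_apply (dual_pair qstar (- xstar)) (s - ?z) \<le> 0"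
      unfolding subdifferential_ereal_iff mem_Collect_eq by blast
    have "dual_pair f 0 = dual_pair pstar xstar + dual_pair qstar (- xstar)"
      by (rule blinfun_eqI) (auto simp: f dual_pair_apply blinfun.add_left blinfun.minus_left)
    then have "blinfun_apply (dual_pair f 0) (s - ?z) \<le> \<phi> s - \<phi> ?z" if "s \<in> S" for s
      using sub[of s] nrm[OF that] by (simp add: blinfun.add_left)
    then show "f \<in> subdifferential (optval \<phi> F C) pbar"
      using subdifferential_optval_iff[OF assms(10)] by (simp add: S_def del: split_paired_All)
  qed
qed

end
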